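(* The exponential generating function $D=D(x,t)=\sum_{n\geqslant 0}D_n(t)\frac{x^n}{n!}$ of the type $D$ Eulerian polynomials satisfies the partial differential equation (subscripts denote partial derivatives) $$ \begin{aligned} &4t^2(1-t)^2[x(1+t)-1]D_{tt}-4t(1-t)(1-2xt)[x(1+t)-1]D_{xt}\\ &+(1-2xt)^2[x(1+t)-1]D_{xx}+2t(1-t)^2[-2+(3+t)x]D_t\\ &+[4t-x(1+3t)^2+2x^2t(3+2t+3t^2)]D_x+(1-t)^2D=0. \end{aligned} $$
   Context: $B_n$ is the group of signed permutations $\pi=\pi_1\pi_2\cdots\pi_n$ of $\{1,\dots,n\}$, and $D_n\subset B_n$ is the subgroup (Coxeter group of type $D$) of those with an even number of negative entries. For $n\geqslant 2$, an index $i\in\{0,1,\dots,n-1\}$ is a ($D$-)descent of $\pi$ if $\pi_i>\pi_{i+1}$, where $\pi_0:=-\pi_2$; $d(\pi)$ is the number of descents. For $n\geqslant 2$, $D_n(t)=\sum_{\pi\in D_n}t^{d(\pi)}$ is the Eulerian polynomial of type $D$; by convention $D_0(t)=D_1(t)=1$. $D(x,t)$ is regarded as a formal power series in $x$ with coefficients polynomials in $t$. *)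

theory Defs
  imports
    "HOL-Analysis.Analysis"
    "HOL-Combinatorics.Permutations"
    "HOL-Computational_Algebra.Formal_Power_Series"
begin

(* B_n, realised as the group of odd permutations (w.r.t. negation) of {-n,...,-1,1,...,n},
   extended by the identity outside this set; the one-line word is \<pi> 1, ..., \<pi> n. *)
definition signed_perms :: "nat \<Rightarrow> (int \<Rightarrow> int) set" where
  "signed_perms n = {\<pi>. \<pi> permutes ({- int n..int n} - {0}) \<and> (\<forall>i. \<pi> (- i) = - \<pi> i)}"

definition even_signed_perms :: "nat \<Rightarrow> (int \<Rightarrow> int) set" where
  "even_signed_perms n = {\<pi> \<in> signed_perms n. even (card {i \<in> {1..int n}. \<pi> i < 0})}"

(* The word with the type D convention \<pi>_0 = - \<pi>_2, which overrides the value
   0 that an odd function takes at 0. *)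
definition entry_D :: "(int \<Rightarrow> int) \<Rightarrow> int \<Rightarrow> int" where
  "entry_D \<pi> i = (if i = 0 then - \<pi> 2 else \<pi> i)"

definition descents_D :: "nat \<Rightarrow> (int \<Rightarrow> int) \<Rightarrow> int set" where
  "descents_D n \<pi> = {i \<in> {0..int n - 1}. entry_D \<pi> i > entry_D \<pi> (i + 1)}"

definition eulerian_D :: "nat \<Rightarrow> real poly" where
  "eulerian_D n =
     (if n < 2 then 1 else (\<Sum>\<pi>\<in>even_signed_perms n. monom 1 (card (descents_D n \<pi>))))"

(* Power series in x whose coefficients are polynomials in t. *)
definition eulerian_D_egf :: "real poly fps" where
  "eulerian_D_egf = Abs_fps (\<lambda>n. smult (1 / fact n) (eulerian_D n))"

(* Partial derivative with respect to t; the one with respect to x is fps_deriv. *)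
definition fps_pderiv_t :: "real poly fps \<Rightarrow> real poly fps" where
  "fps_pderiv_t F = Abs_fps (\<lambda>n. pderiv (fps_nth F n))"

end

theory Submission
  imports Defs "HOL-Combinatorics.Multiset_Permutations" "HOL-Computational_Algebra.Polynomial_FPS"
begin

text \<open>
  Put \<open>L = 2 t (1 - t) d/dt - (1 - 2 x t) d/dx\<close>. This is a derivation, and the differential equation
  is \<open>(x (1 + t) - 1) L\<^sup>2 D + (x (1 + 3 t\<^sup>2) - 2 t) L D + (1 - t)\<^sup>2 D = 0\<close> (\<open>pde_as_operator\<close>).
  It holds because \<open>D = B - x t C\<close>, where \<open>B\<close> is the exponential generating function of the
  Eulerian polynomials of type \<open>B\<close>, and \<open>C\<close> that of the polynomials \<open>2 ^ n A\<^sub>n(t)\<close> for the Eulerian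
  polynomials \<open>A\<^sub>n(t)\<close> of the symmetric groups, and because both satisfy first-order equations:
  \<open>L B = - (1 + t) B\<close> and \<open>L C = - 2 C\<close>. Together with \<open>L x = - (1 - 2 x t)\<close> and
  \<open>L t = 2 t (1 - t)\<close>, these give the claim by a computation in a commutative ring
  (\<open>operator_identity\<close>).

  The decomposition is Stembridge's identity \<open>B\<^sub>n = D\<^sub>n + n 2\<^bsup>n-1\<^esup> t A\<^bsub>n-1\<^esub>\<close> (\<open>stembridge\<close>). It is
  proved by comparing, for a fixed absolute value of the first letter and a fixed remaining word, the
  two signs of the first letter. In type \<open>D\<close> a sign change at the front only interchanges
  the descents at \<open>0\<close> and \<open>1\<close>, so either sign may represent the one with the right parity.

  The first-order equations are the generating-function form of the recurrences that follow from
  the Worpitzky identities \<open>B\<^sub>n = (1 - t)\<^bsup>n+1\<^esup> \<Sum>k. (2 k + 1)\<^sup>n t\<^sup>k\<close> and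
  \<open>2\<^sup>n A\<^sub>n = (1 - t)\<^bsup>n+1\<^esup> \<Sum>k. (2 k + 2)\<^sup>n t\<^sup>k\<close>. Both are instances of one identity for words
  that are preceded by an arbitrary letter \<open>a\<close> (\<open>worpitzky\<close>, \<open>signed_worpitzky\<close>), proved by
  removing the first letter and a telescoping sum.
\<close>

section \<open>Descents of words with a prescribed preceding letter\<close>

fun des :: "'a::linorder list \<Rightarrow> nat" where
  "des (a # b # w) = (if a > b then 1 else 0) + des (b # w)"
| "des _ = 0"

text \<open>Both sums below telescope. As the threshold \<^term>\<open>a\<close> passes downwards over a letter \<^term>\<open>b\<close>,
  the factor of \<^term>\<open>b\<close> in \<open>\<Prod>c\<in>S. if a < c then x + 1 else x\<close> grows from \<^term>\<open>x\<close> to \<^term>\<open>x + 1\<close>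
  and all other factors stay, so that the product grows by exactly the summand of \<^term>\<open>b\<close>. The
  product is \<open>x ^ card S\<close> for a threshold above \<^term>\<open>S\<close> and \<open>(x + 1) ^ card S\<close> for one below.\<close>

lemma telescope_above:
  fixes S :: "'a::linorder set" and x :: "'b::comm_ring_1"
  assumes "finite S"
  shows "(\<Sum>b\<in>{b\<in>S. a < b}. \<Prod>c\<in>S - {b}. if b < c then x + 1 else x) =
         (\<Prod>c\<in>S. if a < c then x + 1 else x) - x ^ card S"
  using assms
proof (induction S rule: finite_linorder_max_induct)
  case empty
  then show ?case by simp
next
  case (insert m S)
  define p where "p = (\<Prod>c\<in>S. if a < c then x + 1 else x)"
  have m: "m \<notin> S" using insert by auto
  have old: "(\<Prod>c\<in>insert m S - {b}. if b < c then x + 1 else x) =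
      (x + 1) * (\<Prod>c\<in>S - {b}. if b < c then x + 1 else x)" if "b \<in> S" for b
  proof -
    have "insert m S - {b} = insert m (S - {b})" using m that by auto
    then show ?thesis using insert that m by simp
  qed
  have new: "(\<Prod>c\<in>insert m S - {m}. if m < c then x + 1 else x) = x ^ card S"
  proof -
    have "insert m S - {m} = S" using m by auto
    moreover have "(\<Prod>c\<in>S. if m < c then x + 1 else x) = (\<Prod>c\<in>S. x)"
      by (rule prod.cong) (use insert in \<open>auto dest: less_asym\<close>)
    ultimately show ?thesis by simp
  qed
  show ?case
  proof (cases "a < m")
    case True
    have "{b \<in> insert m S. a < b} = insert m {b\<in>S. a < b}" using True by auto
    then have "(\<Sum>b\<in>{b\<in>insert m S. a < b}. \<Prod>c\<in>insert m S - {b}. if b < c then x + 1 else x) =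
        x ^ card S + (\<Sum>b\<in>{b\<in>S. a < b}. (x + 1) * (\<Prod>c\<in>S - {b}. if b < c then x + 1 else x))"
      using insert(1) m new by (simp add: old)
    also have "\<dots> = x ^ card S + (x + 1) * (p - x ^ card S)"
      using insert.IH by (simp add: sum_distrib_left[symmetric] p_def)
    finally show ?thesis using True insert(1) m by (simp add: p_def[symmetric] algebra_simps)
  next
    case False
    have none: "{b \<in> insert m S. a < b} = {}" using False insert by auto
    have "(\<Prod>c\<in>insert m S. if a < c then x + 1 else x) = (\<Prod>c\<in>insert m S. x)"
      by (rule prod.cong) (use none in auto)
    then show ?thesis unfolding none by simp
  qed
qed

lemma telescope_below:
  fixes S :: "'a::linorder set" and x :: "'b::comm_ring_1"
  assumes "finite S" "a \<notin> S"
  shows "(\<Sum>b\<in>{b\<in>S. b < a}. \<Prod>c\<in>S - {b}. if b < c then x + 1 else x) =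
         (x + 1) ^ card S - (\<Prod>c\<in>S. if a < c then x + 1 else x)"
  using assms
proof (induction S rule: finite_linorder_min_induct)
  case empty
  then show ?case by simp
next
  case (insert m S)
  define p where "p = (\<Prod>c\<in>S. if a < c then x + 1 else x)"
  have m: "m \<notin> S" using insert by auto
  have old: "(\<Prod>c\<in>insert m S - {b}. if b < c then x + 1 else x) =
      x * (\<Prod>c\<in>S - {b}. if b < c then x + 1 else x)" if "b \<in> S" for b
  proof -
    have "insert m S - {b} = insert m (S - {b})" using m that by auto
    moreover have "\<not> b < m" using insert that by (auto dest: less_asym)
    ultimately show ?thesis using insert that m by simp
  qed
  have new: "(\<Prod>c\<in>insert m S - {m}. if m < c then x + 1 else x) = (x + 1) ^ card S"
  proof -
    have "insert m S - {m} = S" using m by auto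
    moreover have "(\<Prod>c\<in>S. if m < c then x + 1 else x) = (\<Prod>c\<in>S. x + 1)"
      by (rule prod.cong) (use insert in auto)
    ultimately show ?thesis by simp
  qed
  show ?case
  proof (cases "m < a")
    case True
    have "{b \<in> insert m S. b < a} = insert m {b\<in>S. b < a}" using True by auto
    then have "(\<Sum>b\<in>{b\<in>insert m S. b < a}. \<Prod>c\<in>insert m S - {b}. if b < c then x + 1 else x) =
        (x + 1) ^ card S + (\<Sum>b\<in>{b\<in>S. b < a}. x * (\<Prod>c\<in>S - {b}. if b < c then x + 1 else x))"
      using insert(1) m new by (simp add: old)
    also have "\<dots> = (x + 1) ^ card S + x * ((x + 1) ^ card S - p)"
      using insert.IH insert.prems by (simp add: sum_distrib_left[symmetric] p_def)
    finally show ?thesis using less_not_sym[OF True] insert(1) m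
      by (simp add: p_def[symmetric] algebra_simps)
  next
    case False
    have all: "\<forall>b \<in> insert m S. a < b" using False insert by auto
    then have none: "{b \<in> insert m S. b < a} = {}" by (auto dest: less_asym)
    have "(\<Prod>c\<in>insert m S. if a < c then x + 1 else x) = (\<Prod>c\<in>insert m S. x + 1)"
      by (rule prod.cong) (use all in auto)
    then show ?thesis unfolding none by simp
  qed
qed

text \<open>This is the first-letter recursion for the series in \<open>worpitzky\<close>. In degree \<open>k\<close> the letters
  above \<^term>\<open>a\<close> contribute the telescoping sum at \<open>x = k\<close>, and those below contribute, because of
  the factor \<^term>\<open>fps_X\<close> for the descent, the one at \<open>x = k - 1\<close>. The boundary terms
  \<open>k ^ card S\<close> cancel, and the difference of the products for \<open>k\<close> and \<open>k - 1\<close> remains.\<close>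

lemma worpitzky_step:
  fixes S :: "'a::linorder set"
  assumes "finite S" "a \<notin> S" "S \<noteq> {}"
  defines "h \<equiv> \<lambda>T b. Abs_fps (\<lambda>k. \<Prod>c\<in>T. if b < c then of_nat k + 1 else of_nat k) :: real fps"
  shows "(\<Sum>b\<in>S. fps_X ^ (if a > b then 1 else 0) * h (S - {b}) b) = (1 - fps_X) * h S a"
proof (rule fps_ext)
  fix k
  have split: "{b\<in>S. a < b} \<union> {b\<in>S. b < a} = S" using assms(2) by (auto, metis neq_iff)
  have "(\<Sum>b\<in>S. fps_X ^ (if a > b then 1 else 0) * h (S - {b}) b) =
      (\<Sum>b\<in>{b\<in>S. a < b}. fps_X ^ (if a > b then 1 else 0) * h (S - {b}) b) +
      (\<Sum>b\<in>{b\<in>S. b < a}. fps_X ^ (if a > b then 1 else 0) * h (S - {b}) b)"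
    by (subst sum.union_disjoint[symmetric], unfold split)
      (use assms(1) in \<open>auto dest: less_asym\<close>)
  also have "\<dots> = (\<Sum>b\<in>{b\<in>S. a < b}. h (S - {b}) b) +
      fps_X * (\<Sum>b\<in>{b\<in>S. b < a}. h (S - {b}) b)"
    unfolding sum_distrib_left
    by (intro arg_cong2[of _ _ _ _ "(+)"] sum.cong refl) (auto dest: less_asym)
  finally have *: "(\<Sum>b\<in>S. fps_X ^ (if a > b then 1 else 0) * h (S - {b}) b) =
      (\<Sum>b\<in>{b\<in>S. a < b}. h (S - {b}) b) + fps_X * (\<Sum>b\<in>{b\<in>S. b < a}. h (S - {b}) b)" .
  have card: "card S > 0" using assms by (simp add: card_gt_0_iff)
  show "fps_nth (\<Sum>b\<in>S. fps_X ^ (if a > b then 1 else 0) * h (S - {b}) b) k =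
      fps_nth ((1 - fps_X) * h S a) k"
  proof (cases k)
    case 0
    then show ?thesis unfolding * using telescope_above[OF assms(1), where a = a and x = "of_nat 0::real"] card
      by (simp add: fps_sum_nth h_def left_diff_distrib)
  next
    case (Suc j)
    show ?thesis unfolding * Suc
      using telescope_above[OF assms(1), where a = a and x = "of_nat (Suc j)::real"]
        telescope_below[OF assms(1,2), where x = "of_nat j::real"]
      by (simp add: fps_sum_nth h_def left_diff_distrib add_ac)
  qed
qed

text \<open>A Worpitzky identity. The coefficient of \<open>t ^ k\<close> in the series counts the
  maps from \<^term>\<open>S\<close> to \<open>{0..k}\<close> that do not take the value \<^term>\<open>0\<close> on letters
  below \<^term>\<open>a\<close>, which is how it would be obtained from the theory of \<open>P\<close>-partitions. The letter
  \<^term>\<open>a\<close> in front is what makes the first-letter recursion close up.\<close>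

lemma worpitzky:
  fixes S :: "'a::linorder set"
  assumes "finite S" "a \<notin> S"
  shows "fps_of_poly (\<Sum>w\<in>permutations_of_set S. monom (1::real) (des (a # w))) =
    (1 - fps_X) ^ (card S + 1) *
    Abs_fps (\<lambda>k. \<Prod>c\<in>S. if a < c then of_nat k + 1 else of_nat k)"
  using assms
proof (induction "card S" arbitrary: S a)
  case 0
  have "(1 - fps_X) * Abs_fps (\<lambda>k. 1) = (1 :: real fps)"
    by (rule fps_ext) (simp add: left_diff_distrib fps_X_mult_nth)
  with 0 show ?case by simp
next
  case (Suc n)
  define h :: "'a set \<Rightarrow> 'a \<Rightarrow> real fps" where
    "h = (\<lambda>T b. Abs_fps (\<lambda>k. \<Prod>c\<in>T. if b < c then of_nat k + 1 else of_nat k))"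
  have ne: "S \<noteq> {}" using Suc by auto
  have "(\<Sum>w\<in>permutations_of_set S. monom (1::real) (des (a # w))) =
      (\<Sum>b\<in>S. \<Sum>w\<in>(#) b ` permutations_of_set (S - {b}). monom 1 (des (a # w)))"
    unfolding permutations_of_set_nonempty[OF ne]
    by (rule sum.UNION_disjoint) (use Suc.prems in auto)
  also have "\<dots> = (\<Sum>b\<in>S. monom 1 (if a > b then 1 else 0) *
      (\<Sum>w\<in>permutations_of_set (S - {b}). monom 1 (des (b # w))))"
    by (subst sum.reindex) (auto simp: sum_distrib_left mult_monom intro!: sum.cong)
  finally have "fps_of_poly (\<Sum>w\<in>permutations_of_set S. monom (1::real) (des (a # w))) =
      (\<Sum>b\<in>S. fps_X ^ (if a > b then 1 else 0) *
        fps_of_poly (\<Sum>w\<in>permutations_of_set (S - {b}). monom 1 (des (b # w))))"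
    by (simp add: fps_of_poly_sum fps_of_poly_mult fps_of_poly_monom)
  also have "\<dots> = (\<Sum>b\<in>S. fps_X ^ (if a > b then 1 else 0) * ((1 - fps_X) ^ (n + 1) * h (S - {b}) b))"
    using Suc.hyps(2) Suc.prems
    by (intro sum.cong refl, subst Suc.hyps(1)) (auto simp: h_def)
  also have "\<dots> = (1 - fps_X) ^ (n + 1) * (\<Sum>b\<in>S. fps_X ^ (if a > b then 1 else 0) * h (S - {b}) b)"
    by (simp add: sum_distrib_left mult_ac)
  also have "\<dots> = (1 - fps_X) ^ (n + 1) * ((1 - fps_X) * h S a)"
    using worpitzky_step[OF Suc.prems ne] by (simp add: h_def)
  finally show ?case using Suc.hyps(2) by (simp add: h_def mult_ac)
qed

section \<open>Signed words\<close>

definition signed_words :: "int set \<Rightarrow> int list set" where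
  "signed_words V = {w. distinct (map abs w) \<and> abs ` set w = V}"

definition negate_on :: "int set \<Rightarrow> int set \<Rightarrow> int set" where
  "negate_on N V = (V - N) \<union> uminus ` N"

lemma signed_words_empty [simp]: "signed_words {} = {[]}"
  by (auto simp: signed_words_def)

lemma abs_signed_letters:
  assumes "w \<in> signed_words V" "x \<in> set w"
  shows "\<bar>x\<bar> \<in> V"
  using assms by (auto simp: signed_words_def)

lemma finite_signed_words:
  assumes "finite V"
  shows "finite (signed_words V)"
proof (rule finite_subset)
  show "signed_words V \<subseteq> {w. set w \<subseteq> V \<union> uminus ` V \<and> length w = card V}"
  proof
    fix w assume w: "w \<in> signed_words V"
    have "set w \<subseteq> V \<union> uminus ` V"
    proof
      fix x assume "x \<in> set w"
      then have "\<bar>x\<bar> \<in> V" using w by (rule abs_signed_letters[rotated])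
      then show "x \<in> V \<union> uminus ` V" by (cases "x \<ge> 0") (auto intro!: image_eqI[of _ _ "- x"])
    qed
    moreover have "length w = card V"
      using w distinct_card[of "map abs w"] by (simp add: signed_words_def)
    ultimately show "w \<in> {w. set w \<subseteq> V \<union> uminus ` V \<and> length w = card V}" by simp
  qed
  show "finite {w. set w \<subseteq> V \<union> uminus ` V \<and> length w = card V}"
    using assms by (intro finite_lists_length_eq) simp
qed

lemma signed_words_Cons_iff:
  "x # w \<in> signed_words V \<longleftrightarrow> \<bar>x\<bar> \<in> V \<and> w \<in> signed_words (V - {\<bar>x\<bar>})"
  by (auto simp: signed_words_def) (metis image_eqI)

text \<open>Pairing the two signs of the first letter is the device that compares types \<open>B\<close> and \<open>D\<close>, whose
  descents differ only at the front of a word.\<close>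

lemma sum_signed_words_first_letter:
  fixes f :: "int list \<Rightarrow> 'b::comm_monoid_add"
  assumes "finite V" "V \<noteq> {}" "V \<subseteq> {0<..}"
  shows "sum f (signed_words V) =
    (\<Sum>v\<in>V. \<Sum>w\<in>signed_words (V - {v}). f (v # w) + f (- v # w))"
proof -
  define T where "T = Sigma V (\<lambda>v. signed_words (V - {v}))"
  have finT: "finite T" using assms(1) by (auto simp: T_def finite_signed_words)
  have eq: "signed_words V = (\<lambda>(v, w). v # w) ` T \<union> (\<lambda>(v, w). - v # w) ` T"
  proof
    show "signed_words V \<subseteq> (\<lambda>(v, w). v # w) ` T \<union> (\<lambda>(v, w). - v # w) ` T"
    proof
      fix u assume u: "u \<in> signed_words V"
      then have "u \<noteq> []" using assms(2) by (auto simp: signed_words_def)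
      then obtain x w where xw: "u = x # w" by (cases u) auto
      have "(\<bar>x\<bar>, w) \<in> T" using u by (simp add: T_def xw signed_words_Cons_iff)
      moreover have "u = \<bar>x\<bar> # w \<or> u = - \<bar>x\<bar> # w" by (auto simp: xw abs_if)
      ultimately show "u \<in> (\<lambda>(v, w). v # w) ` T \<union> (\<lambda>(v, w). - v # w) ` T" by force
    qed
    show "(\<lambda>(v, w). v # w) ` T \<union> (\<lambda>(v, w). - v # w) ` T \<subseteq> signed_words V"
      using assms(3) by (auto simp: T_def signed_words_Cons_iff subset_iff)
  qed
  have pos: "v > 0" if "(v, w) \<in> T" for v w using that assms(3) by (auto simp: T_def)
  have "(\<lambda>(v, w). v # w) ` T \<inter> (\<lambda>(v, w). - v # w) ` T = {}"
    by (auto dest!: pos)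
  then have "sum f (signed_words V) =
      sum f ((\<lambda>(v, w). v # w) ` T) + sum f ((\<lambda>(v, w). - v # w) ` T)"
    unfolding eq using finT by (intro sum.union_disjoint) auto
  also have "\<dots> = (\<Sum>(v, w)\<in>T. f (v # w)) + (\<Sum>(v, w)\<in>T. f (- v # w))"
    by (subst (1 2) sum.reindex) (auto simp: inj_on_def case_prod_unfold)
  also have "\<dots> = (\<Sum>(v, w)\<in>T. f (v # w) + f (- v # w))"
    by (simp add: sum.distrib case_prod_unfold)
  also have "\<dots> = (\<Sum>v\<in>V. \<Sum>w\<in>signed_words (V - {v}). f (v # w) + f (- v # w))"
    unfolding T_def using assms(1) by (subst sum.Sigma) (auto simp: finite_signed_words)
  finally show ?thesis .
qed

text \<open>Fixing the set of negated letters turns the signed words into permutations of a set of integers,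
  to which the unsigned Worpitzky identity applies.\<close>

lemma signed_words_eq_Union:
  assumes "V \<subseteq> {0<..}"
  shows "signed_words V = (\<Union>N\<in>Pow V. permutations_of_set (negate_on N V))"
proof (intro equalityI subsetI)
  fix w assume w: "w \<in> signed_words V"
  define N where "N = {v \<in> V. - v \<in> set w}"
  have inj: "inj_on abs (set w)" and dist: "distinct w"
    using w by (auto simp: signed_words_def distinct_map)
  have "set w = negate_on N V"
  proof (intro equalityI subsetI)
    fix x assume x: "x \<in> set w"
    have "\<bar>x\<bar> \<in> V" using abs_signed_letters[OF w x] .
    show "x \<in> negate_on N V"
    proof (cases "x > 0")
      case True
      have "- x \<notin> set w"
      proof
        assume "- x \<in> set w"
        then have "x = - x" using inj_onD[OF inj, of x "- x"] x by simp
        with True show False by simp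
      qed
      then show ?thesis using True \<open>\<bar>x\<bar> \<in> V\<close> by (simp add: negate_on_def N_def)
    next
      case False
      then have "- x \<in> N" using x \<open>\<bar>x\<bar> \<in> V\<close> by (simp add: N_def)
      then show ?thesis by (force simp: negate_on_def)
    qed
  next
    fix x assume "x \<in> negate_on N V"
    then consider "x \<in> V" "- x \<notin> set w" | "x \<in> set w"
      by (auto simp: negate_on_def N_def)
    then show "x \<in> set w"
    proof cases
      case 1
      then obtain y where "y \<in> set w" "x = \<bar>y\<bar>" using w by (auto simp: signed_words_def)
      with 1 show ?thesis by (auto simp: abs_if split: if_splits)
    qed
  qed
  with dist show "w \<in> (\<Union>N\<in>Pow V. permutations_of_set (negate_on N V))"
    by (auto simp: permutations_of_set_def N_def)
next
  fix w assume "w \<in> (\<Union>N\<in>Pow V. permutations_of_set (negate_on N V))"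
  then obtain N where N: "N \<subseteq> V" "set w = negate_on N V" "distinct w"
    by (auto simp: permutations_of_set_def)
  have pos: "x > 0" if "x \<in> V" for x using that assms by auto
  have "inj_on abs (negate_on N V)"
  proof (rule inj_onI)
    fix x y assume "x \<in> negate_on N V" "y \<in> negate_on N V" "\<bar>x\<bar> = \<bar>y\<bar>"
    then show "x = y"
      using N(1) pos by (fastforce simp: negate_on_def abs_if split: if_splits)
  qed
  moreover have "abs ` negate_on N V = V"
  proof -
    have "abs ` (V - N) = V - N" "abs ` uminus ` N = N"
      using N(1) pos by (force simp: image_iff abs_if)+
    then show ?thesis using N(1) by (auto simp: negate_on_def image_Un)
  qed
  ultimately show "w \<in> signed_words V"
    using N by (simp add: signed_words_def distinct_map)
qed

lemma negate_on_eq_iff: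
  assumes "V \<subseteq> {0<..}" "N \<subseteq> V" "N' \<subseteq> V"
  shows "negate_on N V = negate_on N' V \<longleftrightarrow> N = N'"
proof -
  have "{v\<in>V. - v \<in> negate_on N V} = N" if "N \<subseteq> V" for N
  proof -
    have "- v \<notin> V" if "v \<in> V" for v
    proof
      assume "- v \<in> V"
      then have "- v > 0" "v > 0" using that assms(1) by auto
      then show False by simp
    qed
    then show ?thesis using that by (auto simp: negate_on_def)
  qed
  then show ?thesis using assms by metis
qed

lemma negated_letters_disjoint:
  fixes V :: "int set"
  assumes "V \<subseteq> {0<..}" "N \<subseteq> V"
  shows "(V - N) \<inter> uminus ` N = {}"
proof -
  have "v > 0" "- u < 0" if "v \<in> V" "u \<in> N" for u v
    using assms that by auto
  then show ?thesis by fastforce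
qed

lemma prod_negate_on:
  fixes f :: "int \<Rightarrow> 'b::comm_monoid_mult"
  assumes "finite V" "V \<subseteq> {0<..}" "N \<subseteq> V"
  shows "prod f (negate_on N V) = (\<Prod>v\<in>N. f (- v)) * (\<Prod>v\<in>V - N. f v)"
proof -
  have "prod f (negate_on N V) = prod f (V - N) * prod f (uminus ` N)"
    unfolding negate_on_def using assms finite_subset[OF assms(3,1)]
    by (intro prod.union_disjoint negated_letters_disjoint) auto
  also have "prod f (uminus ` N) = (\<Prod>v\<in>N. f (- v))"
    by (subst prod.reindex) (auto simp: inj_on_def)
  finally show ?thesis by (simp add: mult_ac)
qed

lemma card_negate_on:
  assumes "finite V" "V \<subseteq> {0<..}" "N \<subseteq> V"
  shows "card (negate_on N V) = card V"
proof -
  have "card (negate_on N V) = card (V - N) + card (uminus ` N)"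
    unfolding negate_on_def using assms finite_subset[OF assms(3,1)]
    by (intro card_Un_disjoint negated_letters_disjoint) auto
  also have "\<dots> = card V"
    using assms by (simp add: card_image card_Diff_subset finite_subset card_mono)
  finally show ?thesis .
qed

text \<open>Summing the unsigned identity over the choices of signs expands a product: each
  \<^term>\<open>v \<in> V\<close> contributes the factor for the letter \<^term>\<open>- v\<close> plus the factor for the letter
  \<^term>\<open>v\<close>.\<close>

lemma signed_worpitzky:
  assumes "finite V" "V \<subseteq> {0<..}" "\<bar>a\<bar> \<notin> V"
  shows "fps_of_poly (\<Sum>w\<in>signed_words V. monom (1::real) (des (a # w))) =
    (1 - fps_X) ^ (card V + 1) * Abs_fps (\<lambda>k. \<Prod>v\<in>V.
      (if a < - v then of_nat k + 1 else of_nat k) + (if a < v then of_nat k + 1 else of_nat k))"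
proof -
  have fin: "finite (negate_on N V)" if "N \<subseteq> V" for N
    using assms(1) that finite_subset by (auto simp: negate_on_def)
  have a: "a \<notin> negate_on N V" if "N \<subseteq> V" for N
    using that assms(2,3) by (force simp: negate_on_def)
  have disj: "permutations_of_set (negate_on N V) \<inter> permutations_of_set (negate_on N' V) = {}"
    if "N \<subseteq> V" "N' \<subseteq> V" "N \<noteq> N'" for N N'
    using negate_on_eq_iff[OF assms(2) that(1,2)] that(3) by (auto simp: permutations_of_set_def)
  have "(\<Sum>w\<in>signed_words V. monom (1::real) (des (a # w))) =
      (\<Sum>N\<in>Pow V. \<Sum>w\<in>permutations_of_set (negate_on N V). monom 1 (des (a # w)))"
    unfolding signed_words_eq_Union[OF assms(2)]
    by (rule sum.UNION_disjoint) (use assms(1) disj in auto)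
  then have "fps_of_poly (\<Sum>w\<in>signed_words V. monom (1::real) (des (a # w))) =
      (\<Sum>N\<in>Pow V. fps_of_poly (\<Sum>w\<in>permutations_of_set (negate_on N V). monom 1 (des (a # w))))"
    by (simp only: fps_of_poly_sum)
  also have "\<dots> = (\<Sum>N\<in>Pow V. (1 - fps_X) ^ (card V + 1) *
        Abs_fps (\<lambda>k. \<Prod>c\<in>negate_on N V. if a < c then of_nat k + 1 else of_nat k))"
    by (intro sum.cong refl)
      (simp only: Pow_iff worpitzky[OF fin a] card_negate_on[OF assms(1,2)])
  also have "\<dots> = (1 - fps_X) ^ (card V + 1) * Abs_fps (\<lambda>k. \<Sum>N\<in>Pow V.
        \<Prod>c\<in>negate_on N V. if a < c then of_nat k + 1 else of_nat k)"
    unfolding sum_distrib_left[symmetric]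
    by (rule arg_cong[of _ _ "(*) _"]) (simp add: fps_eq_iff fps_sum_nth)
  also have "(\<lambda>k. \<Sum>N\<in>Pow V. \<Prod>c\<in>negate_on N V. if a < c then of_nat k + 1 else of_nat k) =
      (\<lambda>k. \<Prod>v\<in>V. (if a < - v then of_nat k + 1 else of_nat k)
        + (if a < v then of_nat k + 1 else (of_nat k :: real)))"
    by (rule ext, subst prod_add[OF assms(1)], rule sum.cong)
      (use assms in \<open>auto simp: prod_negate_on\<close>)
  finally show ?thesis .
qed

text \<open>Relative to the threshold \<^term>\<open>0\<close> exactly one of \<^term>\<open>v\<close> and \<^term>\<open>- v\<close> is large, so every
  factor is \<open>(k + 1) + k\<close>.\<close>

lemma worpitzky_type_B:
  assumes "finite V" "V \<subseteq> {0<..}"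
  shows "fps_of_poly (\<Sum>w\<in>signed_words V. monom (1::real) (des (0 # w))) =
    (1 - fps_X) ^ (card V + 1) * Abs_fps (\<lambda>k. (2 * of_nat k + 1) ^ card V)"
proof -
  have "(\<Prod>v\<in>V. (if 0 < - v then of_nat k + 1 else of_nat k)
      + (if 0 < v then of_nat k + 1 else of_nat k)) = (\<Prod>v\<in>V. 2 * of_nat k + (1::real))" for k
    by (rule prod.cong) (use assms(2) in auto)
  moreover have "\<bar>0\<bar> \<notin> V" using assms(2) by auto
  ultimately show ?thesis using signed_worpitzky[OF assms, of 0] by simp
qed

text \<open>A letter below all others can be put in front without creating a descent; then both signs give
  the factor \<open>k + 1\<close>.\<close>

lemma worpitzky_signed_type_A:
  assumes "finite V" "V \<subseteq> {0<..}"
  shows "fps_of_poly (\<Sum>w\<in>signed_words V. monom (1::real) (des w)) =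
    (1 - fps_X) ^ (card V + 1) * Abs_fps (\<lambda>k. (2 * of_nat k + 2) ^ card V)"
proof -
  \<comment> \<open>The members of \<^term>\<open>V\<close> are positive, so each is at most their sum and all letters exceed \<open>a\<close>.\<close>
  define a where "a = - (1 + (\<Sum>v\<in>V. v))"
  have a: "a < - v" "a < v" if "v \<in> V" for v
  proof -
    have "v \<le> (\<Sum>v\<in>V. v)" using assms that by (intro member_le_sum) force+
    moreover have "v > 0" using assms(2) that by auto
    ultimately show "a < - v" "a < v" by (auto simp: a_def)
  qed
  have "des (a # w) = des w" if "w \<in> signed_words V" for w
  proof (cases w)
    case (Cons x w')
    then have "\<bar>x\<bar> \<in> V" using that by (simp add: signed_words_Cons_iff)
    then have "a < x" using a[of "\<bar>x\<bar>"] by linarith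
    then show ?thesis by (simp add: Cons)
  qed simp
  moreover have "\<bar>a\<bar> \<notin> V" using a[of "\<bar>a\<bar>"] by auto
  moreover have "(\<Prod>v\<in>V. (if a < - v then of_nat k + 1 else of_nat k)
      + (if a < v then of_nat k + 1 else of_nat k)) = (\<Prod>v\<in>V. 2 * of_nat k + (2::real))" for k
    by (rule prod.cong) (use a in auto)
  ultimately show ?thesis using signed_worpitzky[OF assms, of a] by simp
qed

section \<open>Type D descents and signed words\<close>

text \<open>
  The two letters at the front are addressed by position, so this is meant for words of length at
  least \<^term>\<open>2::nat\<close>. The extra summand is the descent at \<^term>\<open>0::nat\<close>.
\<close>

definition des_D :: "int list \<Rightarrow> nat" where
  "des_D w = (if - (w ! 1) > w ! 0 then 1 else 0) + des w"

text \<open>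
  The letter \<^term>\<open>0::int\<close> in front is the type \<open>B\<close> convention \<open>\<pi>\<^sub>0 = 0\<close>.
\<close>

definition type_B_poly :: "nat \<Rightarrow> real poly" where
  "type_B_poly n = (\<Sum>w\<in>signed_words {1..int n}. monom 1 (des (0 # w)))"

text \<open>
  The words are signed but the descents are those of type \<open>A\<close>. As each choice of signs leaves
  \<open>n\<close> distinct letters to be permuted, this is \<open>2 ^ n\<close> times the Eulerian polynomial of the
  symmetric group.
\<close>

definition signed_A_poly :: "nat \<Rightarrow> real poly" where
  "signed_A_poly n = (\<Sum>w\<in>signed_words {1..int n}. monom 1 (des w))"

lemma des_map_upto:
  fixes f :: "int \<Rightarrow> 'a::linorder"
  shows "des (map f [i..j]) = card {k \<in> {i..j - 1}. f k > f (k + 1)}"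
proof (induction i j rule: upto.induct)
  case (1 i j)
  show ?case
  proof (cases "i < j")
    case False
    then show ?thesis by (cases "i = j") auto
  next
    case True
    define A where "A = {k \<in> {i + 1..j - 1}. f k > f (k + 1)}"
    have "finite A" "i \<notin> A"
      by (auto simp: A_def intro: finite_subset[of _ "{i + 1..j - 1}"])
    moreover have "{k \<in> {i..j - 1}. f k > f (k + 1)} = (if f i > f (i + 1) then insert i A else A)"
    proof -
      have "k \<in> {k \<in> {i..j - 1}. f k > f (k + 1)} \<longleftrightarrow> (k = i \<and> f i > f (i + 1)) \<or> k \<in> A" for k
        using True by (cases "k = i") (auto simp: A_def)
      then show ?thesis by auto
    qed
    moreover have "des (map f [i + 1..j]) = card A"
      using 1 True by (simp only: A_def)
    moreover have "[i..j] = i # (i + 1) # [i + 2..j]" "[i + 1..j] = (i + 1) # [i + 2..j]"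
      using True upto_rec1[of i j] upto_rec1[of "i + 1" j] by (simp_all add: add.commute)
    ultimately show ?thesis by simp
  qed
qed

lemma des_D_window:
  assumes "n \<ge> 2"
  shows "card (descents_D n \<pi>) = des_D (map \<pi> [1..int n])"
proof -
  define A where "A = {k \<in> {1..int n - 1}. \<pi> k > \<pi> (k + 1)}"
  have "finite A" "0 \<notin> A"
    by (auto simp: A_def intro: finite_subset[of _ "{1..int n - 1}"])
  moreover have "descents_D n \<pi> = (if - \<pi> 2 > \<pi> 1 then insert 0 A else A)"
  proof -
    have "i \<in> descents_D n \<pi> \<longleftrightarrow> (i = 0 \<and> - \<pi> 2 > \<pi> 1) \<or> i \<in> A" for i
      using assms by (auto simp: descents_D_def A_def entry_D_def)
    then show ?thesis by auto
  qed
  moreover have "map \<pi> [1..int n] ! 0 = \<pi> 1" "map \<pi> [1..int n] ! 1 = \<pi> 2"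
    using assms by (simp_all add: nth_upto)
  moreover have "des (map \<pi> [1..int n]) = card A"
    by (simp only: des_map_upto A_def)
  ultimately show ?thesis by (simp add: des_D_def)
qed

text \<open>A signed permutation is determined by its values on the positive integers, since it is odd. For
  surjectivity, a signed word is extended to an odd function.\<close>

lemma bij_betw_window:
  "bij_betw (\<lambda>\<pi>. map \<pi> [1..int n]) (signed_perms n) (signed_words {1..int n})"
proof (rule bij_betwI')
  fix \<pi> \<sigma> assume \<pi>: "\<pi> \<in> signed_perms n" and \<sigma>: "\<sigma> \<in> signed_perms n"
  show "map \<pi> [1..int n] = map \<sigma> [1..int n] \<longleftrightarrow> \<pi> = \<sigma>"
  proof
    assume eq: "map \<pi> [1..int n] = map \<sigma> [1..int n]"
    show "\<pi> = \<sigma>"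
    proof
      fix i
      have pos: "\<pi> k = \<sigma> k" if "k \<in> {1..int n}" for k using eq that by simp
      consider "i \<in> {1..int n}" | "- i \<in> {1..int n}" | "i \<notin> {- int n..int n} - {0}"
        by force
      then show "\<pi> i = \<sigma> i"
      proof cases
        case 1
        then show ?thesis by (rule pos)
      next
        case 2
        have "\<pi> (- (- i)) = \<sigma> (- (- i))" using \<pi> \<sigma> pos[OF 2] by (simp only: signed_perms_def mem_Collect_eq)
        then show ?thesis by simp
      next
        case 3
        then show ?thesis using \<pi> \<sigma> by (auto simp: signed_perms_def permutes_def)
      qed
    qed
  qed simp
next
  fix \<pi> assume "\<pi> \<in> signed_perms n"
  then have perm: "\<pi> permutes ({- int n..int n} - {0})" and odd: "\<And>i. \<pi> (- i) = - \<pi> i"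
    by (auto simp: signed_perms_def)
  have "inj_on (\<lambda>i. \<bar>\<pi> i\<bar>) {1..int n}"
  proof (rule inj_onI)
    fix i j assume ij: "i \<in> {1..int n}" "j \<in> {1..int n}" "\<bar>\<pi> i\<bar> = \<bar>\<pi> j\<bar>"
    then have "\<pi> i = \<pi> j \<or> \<pi> i = \<pi> (- j)" by (auto simp: abs_eq_iff odd)
    then have "i = j \<or> i = - j" using permutes_inj[OF perm] by (auto dest: injD)
    then show "i = j" using ij by auto
  qed
  moreover have "(\<lambda>i. \<bar>\<pi> i\<bar>) ` {1..int n} \<subseteq> {1..int n}"
  proof
    fix y assume "y \<in> (\<lambda>i. \<bar>\<pi> i\<bar>) ` {1..int n}"
    then obtain i where i: "i \<in> {1..int n}" "y = \<bar>\<pi> i\<bar>" by auto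
    then have "\<pi> i \<in> {- int n..int n} - {0}" by (subst permutes_in_image[OF perm]) auto
    then show "y \<in> {1..int n}" using i by auto
  qed
  ultimately have range: "(\<lambda>i. \<bar>\<pi> i\<bar>) ` {1..int n} = {1..int n}"
    and inj: "inj_on (\<lambda>i. \<bar>\<pi> i\<bar>) {1..int n}"
    using endo_inj_surj[of "{1..int n}" "\<lambda>i. \<bar>\<pi> i\<bar>"] by simp_all
  have abs: "map abs (map \<pi> [1..int n]) = map (\<lambda>i. \<bar>\<pi> i\<bar>) [1..int n]" by simp
  show "map \<pi> [1..int n] \<in> signed_words {1..int n}"
    unfolding signed_words_def mem_Collect_eq abs using range inj
    by (simp add: distinct_map image_image)
next
  fix w assume w: "w \<in> signed_words {1..int n}"
  have len: "length w = n"
    using w distinct_card[of "map abs w"] by (simp add: signed_words_def)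
  define p where "p = (\<lambda>i. w ! nat (i - 1))"
  define \<pi> where "\<pi> = (\<lambda>i. if i \<in> {1..int n} then p i else if - i \<in> {1..int n} then - p (- i) else i)"
  have win: "map \<pi> [1..int n] = w"
    by (rule nth_equalityI) (auto simp: len \<pi>_def p_def)
  have p_in: "\<bar>p i\<bar> \<in> {1..int n}" if "i \<in> {1..int n}" for i
  proof (rule abs_signed_letters[OF w])
    show "p i \<in> set w" using that len by (auto simp: p_def intro!: nth_mem)
  qed
  have p_inj: "i = j" if "i \<in> {1..int n}" "j \<in> {1..int n}" "\<bar>p i\<bar> = \<bar>p j\<bar>" for i j
  proof -
    have "nat (i - 1) < length w" "nat (j - 1) < length w" using that len by auto
    then have "map abs w ! nat (i - 1) = map abs w ! nat (j - 1)" using that(3) by (simp add: p_def)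
    moreover have "distinct (map abs w)" using w by (simp add: signed_words_def)
    ultimately have "nat (i - 1) = nat (j - 1)"
      using that len by (subst (asm) nth_eq_iff_index_eq) auto
    then show ?thesis using that by auto
  qed
  have abs_in: "\<bar>i\<bar> \<in> {1..int n}" if "i \<in> {- int n..int n} - {0}" for i
    using that by (auto simp: abs_if)
  have odd: "\<pi> (- i) = - \<pi> i" for i by (auto simp: \<pi>_def)
  have abs_\<pi>: "\<bar>\<pi> i\<bar> = \<bar>p \<bar>i\<bar>\<bar>" if "i \<in> {- int n..int n} - {0}" for i
    using that by (auto simp: \<pi>_def abs_if)
  have "\<pi> permutes ({- int n..int n} - {0})"
  proof (rule inj_imp_permutes)
    show "inj_on \<pi> ({- int n..int n} - {0})"
    proof (rule inj_onI)
      fix i j assume ij: "i \<in> {- int n..int n} - {0}" "j \<in> {- int n..int n} - {0}" "\<pi> i = \<pi> j"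
      then have "\<bar>p \<bar>i\<bar>\<bar> = \<bar>p \<bar>j\<bar>\<bar>" using abs_\<pi>[of i] abs_\<pi>[of j] by simp
      then have "\<bar>i\<bar> = \<bar>j\<bar>" by (rule p_inj[rotated 2]) (use ij in auto)
      moreover have "i \<noteq> - j"
      proof
        assume "i = - j"
        then have "\<pi> j = 0" using ij(3) odd[of j] by simp
        then have "p \<bar>j\<bar> = 0" using abs_\<pi>[OF ij(2)] by simp
        then show False using p_in[OF abs_in[OF ij(2)]] by simp
      qed
      ultimately show "i = j" by (auto simp: abs_eq_iff)
    qed
    show "\<pi> i \<in> {- int n..int n} - {0}" if "i \<in> {- int n..int n} - {0}" for i
    proof -
      have "\<bar>\<pi> i\<bar> \<in> {1..int n}" using p_in[OF abs_in[OF that]] abs_\<pi>[OF that] by simp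
      then show ?thesis by auto
    qed
    show "\<pi> i = i" if "i \<notin> {- int n..int n} - {0}" for i
      using that by (auto simp: \<pi>_def)
  qed simp
  then have "\<pi> \<in> signed_perms n" using odd by (simp add: signed_perms_def)
  then show "\<exists>\<pi>\<in>signed_perms n. w = map \<pi> [1..int n]" using win by auto
qed

lemma eulerian_D_words:
  assumes "n \<ge> 2"
  shows "eulerian_D n = (\<Sum>w\<in>signed_words {1..int n}.
    if even (length (filter (\<lambda>x. x < 0) w)) then monom 1 (des_D w) else 0)"
proof -
  define e where "e = (\<lambda>w. even (length (filter (\<lambda>x::int. x < 0) w)))"
  have bij: "bij_betw (\<lambda>\<pi>. map \<pi> [1..int n]) (even_signed_perms n) {w\<in>signed_words {1..int n}. e w}"
  proof -
    have "card {i \<in> {1..int n}. \<pi> i < 0} = length (filter (\<lambda>x. x < 0) (map \<pi> [1..int n]))"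
      for \<pi> :: "int \<Rightarrow> int"
      by (simp add: filter_map comp_def distinct_length_filter Int_def conj_commute)
    then have "even_signed_perms n = {\<pi> \<in> signed_perms n. e (map \<pi> [1..int n])}"
      by (simp add: even_signed_perms_def e_def)
    then show ?thesis using bij_betw_window[of n] by (auto simp: bij_betw_def inj_on_def)
  qed
  have "eulerian_D n = (\<Sum>\<pi>\<in>even_signed_perms n. monom 1 (des_D (map \<pi> [1..int n])))"
    using assms by (simp add: eulerian_D_def des_D_window)
  also have "\<dots> = (\<Sum>w\<in>{w\<in>signed_words {1..int n}. e w}. monom 1 (des_D w))"
    by (rule sum.reindex_bij_betw[OF bij])
  also have "\<dots> = (\<Sum>w\<in>signed_words {1..int n}. if e w then monom 1 (des_D w) else 0)"
    by (rule sum.inter_filter) (simp add: finite_signed_words)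
  finally show ?thesis by (simp add: e_def)
qed

text \<open>Changing the sign of the first letter \<^term>\<open>v\<close> interchanges the type \<open>D\<close> descents at positions
  \<open>0\<close> and \<open>1\<close>, that is, \<open>- b > v\<close> and \<open>v > b\<close>; this reflects the symmetry of the Coxeter
  diagram. For the second part, the numbers of descents at the front are as
  follows, apart from those within \<open>b # w\<close>: for \<open>b > v\<close> the two signs give \<open>0\<close> and \<open>1\<close> in type
  \<open>B\<close> and \<open>0\<close> in type \<open>D\<close>; for \<open>- v < b < v\<close> they give \<open>1\<close>, \<open>1\<close> and \<open>1\<close>; for \<open>b < - v\<close> they
  give \<open>1\<close>, \<open>2\<close> and \<open>2\<close>. What type \<open>B\<close> has in excess is always one term with one descent.\<close>

lemma first_letter_exchange:
  fixes v b :: int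
  assumes "v > 0" "\<bar>b\<bar> \<noteq> v"
  shows "des_D (- v # b # w) = des_D (v # b # w)"
    and "monom (1::real) (des (0 # v # b # w)) + monom 1 (des (0 # - v # b # w)) =
      monom 1 (des_D (v # b # w)) + [:0, 1:] * monom 1 (des (b # w))"
proof -
  consider "b > v" | "- v < b" "b < v" | "b < - v"
    using assms by linarith
  note cases = this
  show "des_D (- v # b # w) = des_D (v # b # w)"
    using cases assms by cases (auto simp: des_D_def)
  show "monom (1::real) (des (0 # v # b # w)) + monom 1 (des (0 # - v # b # w)) =
      monom 1 (des_D (v # b # w)) + [:0, 1:] * monom 1 (des (b # w))"
    using cases assms by cases (auto simp: des_D_def monom_Suc)
qed

text \<open>Only the relative order of the letters matters; instead of relabelling the letters it is simpler
  to observe that the Worpitzky identity determines the polynomial from the number of letters.\<close>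

lemma signed_A_poly_remove:
  assumes "v \<in> {1..int n}"
  shows "(\<Sum>w\<in>signed_words ({1..int n} - {v}). monom 1 (des w)) = signed_A_poly (n - 1)"
proof -
  have "card ({1..int n} - {v}) = n - 1" using assms by simp
  then have "fps_of_poly (\<Sum>w\<in>signed_words ({1..int n} - {v}). monom (1::real) (des w)) =
      fps_of_poly (signed_A_poly (n - 1))"
    unfolding signed_A_poly_def by (subst (1 2) worpitzky_signed_type_A) auto
  then show ?thesis by (simp only: fps_of_poly_eq_iff)
qed

text \<open>Stembridge's identity, usually written \<open>B\<^sub>n = D\<^sub>n + n 2\<^bsup>n-1\<^esup> t A\<^bsub>n-1\<^esub>\<close>. Both sides are summed over
  the first absolute value \<open>v\<close> and the remaining word \<open>w\<close>. Exactly one of \<open>v # w\<close> and \<open>- v # w\<close>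
  has an even number of negative letters, and it does not matter for the type \<open>D\<close> descents which.
  That needs a second letter; for \<open>n = 1\<close> the identity reads \<open>1 + t = 1 + t\<close>, by the convention
  that \<open>D\<^sub>1 = 1\<close>.\<close>

lemma stembridge:
  assumes "n \<ge> 1"
  shows "type_B_poly n = eulerian_D n + of_nat n * [:0, 1:] * signed_A_poly (n - 1)"
proof (cases "n = 1")
  case True
  have "{1..1} = {1::int}" by auto
  then show ?thesis unfolding True
    by (simp add: type_B_poly_def signed_A_poly_def eulerian_D_def sum_signed_words_first_letter
        monom_Suc one_pCons monom_0)
next
  case False
  then have n: "n \<ge> 2" using assms by simp
  let ?V = "{1..int n}" and ?e = "\<lambda>w. even (length (filter (\<lambda>x::int. x < 0) w))"
  have first: "sum f (signed_words ?V) =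
      (\<Sum>v\<in>?V. \<Sum>w\<in>signed_words (?V - {v}). f (v # w) + f (- v # w))" for f :: "int list \<Rightarrow> real poly"
    by (rule sum_signed_words_first_letter) (use n in auto)
  have D: "eulerian_D n = (\<Sum>v\<in>?V. \<Sum>w\<in>signed_words (?V - {v}). monom 1 (des_D (v # w)))"
    and B: "type_B_poly n = (\<Sum>v\<in>?V. \<Sum>w\<in>signed_words (?V - {v}).
      monom 1 (des_D (v # w)) + [:0, 1:] * monom 1 (des w))"
  proof -
    have tail: "\<exists>b u. w = b # u \<and> \<bar>b\<bar> \<noteq> v" if v: "v \<in> ?V" and w: "w \<in> signed_words (?V - {v})" for v w
    proof -
      have "card (?V - {v}) \<noteq> 0" using v n by simp
      then have "?V - {v} \<noteq> {}" by (metis card.empty)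
      then have "w \<noteq> []" using w by (auto simp: signed_words_def)
      then obtain b u where "w = b # u" by (cases w) auto
      then show ?thesis using w by (auto simp: signed_words_Cons_iff)
    qed
    show "eulerian_D n = (\<Sum>v\<in>?V. \<Sum>w\<in>signed_words (?V - {v}). monom 1 (des_D (v # w)))"
      unfolding eulerian_D_words[OF n] first
    proof (intro sum.cong refl)
      fix v w assume vw: "v \<in> ?V" "w \<in> signed_words (?V - {v})"
      then show "(if ?e (v # w) then monom 1 (des_D (v # w)) else 0) +
          (if ?e (- v # w) then monom 1 (des_D (- v # w)) else 0) = monom (1::real) (des_D (v # w))"
        using tail[OF vw] first_letter_exchange(1)[of v] by auto
    qed
    show "type_B_poly n = (\<Sum>v\<in>?V. \<Sum>w\<in>signed_words (?V - {v}).
        monom 1 (des_D (v # w)) + [:0, 1:] * monom 1 (des w))"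
      unfolding type_B_poly_def first
    proof (intro sum.cong refl)
      fix v w assume vw: "v \<in> ?V" "w \<in> signed_words (?V - {v})"
      then show "monom (1::real) (des (0 # v # w)) + monom 1 (des (0 # - v # w)) =
          monom 1 (des_D (v # w)) + [:0, 1:] * monom 1 (des w)"
        using tail[OF vw] first_letter_exchange(2)[of v] by fastforce
    qed
  qed
  have "(\<Sum>v\<in>?V. \<Sum>w\<in>signed_words (?V - {v}). [:0, 1:] * monom (1::real) (des w)) =
      (\<Sum>v\<in>?V. [:0, 1:] * signed_A_poly (n - 1))"
    by (intro sum.cong refl) (simp add: sum_distrib_left[symmetric] signed_A_poly_remove del: mult_pCons_left)
  also have "\<dots> = of_nat n * [:0, 1:] * signed_A_poly (n - 1)" by (simp add: mult_ac)
  finally show ?thesis by (simp add: B D sum.distrib del: mult_pCons_left)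
qed

section \<open>First-order equations for the generating functions\<close>

text \<open>
  Multiplying the coefficient of \<open>t ^ k\<close> by \<open>2 * k + d\<close> is the operator \<open>2 t d/dt + d\<close> on the
  series; conjugating it by the power of \<open>1 - t\<close> gives the recurrence. It covers type
  \<open>B\<close> (\<open>d = 1\<close>) and signed type \<open>A\<close> (\<open>d = 2\<close>) at once.
\<close>

lemma worpitzky_recurrence:
  fixes p q :: "real poly"
  assumes p: "fps_of_poly p = (1 - fps_X) ^ (n + 1) * Abs_fps (\<lambda>k. (2 * of_nat k + d) ^ n)"
    and q: "fps_of_poly q = (1 - fps_X) ^ (n + 2) * Abs_fps (\<lambda>k. (2 * of_nat k + d) ^ (n + 1))"
  shows "q = 2 * [:0, 1:] * (1 - [:0, 1:]) * pderiv p
    + (2 * of_nat (n + 1) * [:0, 1:] + [:d:] * (1 - [:0, 1:])) * p"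
proof -
  define F where "F = Abs_fps (\<lambda>k. (2 * of_nat k + d) ^ n)"
  have "Abs_fps (\<lambda>k. (2 * of_nat k + d) ^ (n + 1)) = 2 * fps_X * fps_deriv F + fps_const d * F"
    by (rule fps_ext) (auto simp: F_def algebra_simps fps_numeral_fps_const fps_mult_left_const_nth)
  then have q': "fps_of_poly q = (1 - fps_X) ^ (n + 2) * (2 * fps_X * fps_deriv F + fps_const d * F)"
    using q by simp
  have dp: "fps_of_poly (pderiv p) =
      (1 - fps_X) ^ (n + 1) * fps_deriv F - of_nat (n + 1) * (1 - fps_X) ^ n * F"
  proof -
    have "fps_deriv ((1 - fps_X) ^ (m + 1)) = - (of_nat (m + 1) * (1 - fps_X) ^ m :: real fps)" for m
      by (subst fps_deriv_power') (simp add: algebra_simps)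
    then show ?thesis
      unfolding fps_of_poly_pderiv p F_def[symmetric] by (simp only: fps_deriv_mult) (simp add: algebra_simps)
  qed
  have hom: "fps_of_poly [:0, 1::real:] = fps_X" "fps_of_poly [:d:] = fps_const d"
      "fps_of_poly (2::real poly) = 2" "fps_of_poly (of_nat m :: real poly) = of_nat m" for m
    by (simp_all add: fps_of_poly_pCons, induction m) (simp_all add: fps_of_poly_add)
  have "fps_of_poly q = fps_of_poly (2 * [:0, 1:] * (1 - [:0, 1:]) * pderiv p
    + (2 * of_nat (n + 1) * [:0, 1:] + [:d:] * (1 - [:0, 1:])) * p)"
    unfolding fps_of_poly_add fps_of_poly_mult fps_of_poly_diff fps_of_poly_1 hom dp q'
      p F_def[symmetric]
    by (simp add: algebra_simps)
  then show ?thesis by (simp only: fps_of_poly_eq_iff)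
qed

lemma fps_pderiv_t_nth [simp]: "fps_nth (fps_pderiv_t F) n = pderiv (fps_nth F n)"
  by (simp add: fps_pderiv_t_def)

lemma fps_pderiv_t_add [simp]: "fps_pderiv_t (F + G) = fps_pderiv_t F + fps_pderiv_t G"
  by (simp add: fps_eq_iff pderiv_add)

lemma fps_pderiv_t_diff [simp]: "fps_pderiv_t (F - G) = fps_pderiv_t F - fps_pderiv_t G"
  by (simp add: fps_eq_iff pderiv_diff)

lemma pderiv_sum: "pderiv (sum f A) = (\<Sum>a\<in>A. pderiv (f a))"
  by (induction A rule: infinite_finite_induct) (simp_all add: pderiv_add)

lemma fps_pderiv_t_mult [simp]:
  "fps_pderiv_t (F * G) = F * fps_pderiv_t G + fps_pderiv_t F * G"
  by (rule fps_ext)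
    (simp add: fps_mult_nth pderiv_sum pderiv_mult sum.distrib mult.commute[of "pderiv _"])

lemma fps_pderiv_t_const [simp]: "fps_pderiv_t (fps_const p) = fps_const (pderiv p)"
  by (simp add: fps_eq_iff)

lemma fps_pderiv_t_X [simp]: "fps_pderiv_t fps_X = 0"
  by (simp add: fps_eq_iff fps_X_def)

lemma fps_pderiv_t_0 [simp]: "fps_pderiv_t 0 = 0"
  by (simp add: fps_eq_iff)

lemma fps_pderiv_t_1 [simp]: "fps_pderiv_t 1 = 0"
  by (simp add: fps_eq_iff)

lemma fps_pderiv_t_numeral [simp]: "fps_pderiv_t (numeral m) = 0"
  by (simp add: fps_eq_iff fps_numeral_nth)

lemma fps_pderiv_t_deriv: "fps_pderiv_t (fps_deriv F) = fps_deriv (fps_pderiv_t F)"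
  by (simp add: fps_eq_iff pderiv_smult of_nat_poly)

definition fps_t :: "real poly fps" where
  "fps_t = fps_const [:0, 1:]"

lemma fps_pderiv_t_t [simp]: "fps_pderiv_t fps_t = 1"
  by (simp add: fps_t_def pderiv_pCons one_pCons)

lemma fps_deriv_t [simp]: "fps_deriv fps_t = 0"
  by (simp add: fps_t_def)

text \<open>This is the operator \<open>L\<close> of the introduction. It collects the derivatives that
  \<open>worpitzky_recurrence\<close> produces on exponential generating functions, where passing from \<open>n\<close> to
  \<open>n + 1\<close> is \<open>d/dx\<close> and multiplication by \<open>n\<close> is \<open>x d/dx\<close>.\<close>

definition eulerian_derivation :: "real poly fps \<Rightarrow> real poly fps" where
  "eulerian_derivation F =
    2 * fps_t * (1 - fps_t) * fps_pderiv_t F - (1 - 2 * fps_X * fps_t) * fps_deriv F"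

lemma eulerian_derivation_add:
  "eulerian_derivation (F + G) = eulerian_derivation F + eulerian_derivation G"
  and eulerian_derivation_diff:
  "eulerian_derivation (F - G) = eulerian_derivation F - eulerian_derivation G"
  and eulerian_derivation_mult:
  "eulerian_derivation (F * G) = eulerian_derivation F * G + F * eulerian_derivation G"
  and eulerian_derivation_t: "eulerian_derivation fps_t = 2 * fps_t * (1 - fps_t)"
  and eulerian_derivation_X: "eulerian_derivation fps_X = - (1 - 2 * fps_X * fps_t)"
  and eulerian_derivation_1: "eulerian_derivation 1 = 0"
  and eulerian_derivation_numeral: "eulerian_derivation (numeral m) = 0"
  by (simp_all add: eulerian_derivation_def algebra_simps)

text \<open>The second-order part of the equation is \<open>x (1 + t) - 1\<close> times the square of the symbol of the
  derivation \<open>L\<close>. After subtracting \<open>(x (1 + t) - 1) L\<^sup>2\<close>, the remaining first-order terms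
  are a multiple of \<open>L\<close>, so that \<open>L\<close> alone is left.\<close>

lemma pde_as_operator:
  fixes F :: "real poly fps"
  defines "x \<equiv> fps_X" and "t \<equiv> fps_t" and "L \<equiv> eulerian_derivation"
  shows "4 * t^2 * (1 - t)^2 * (x * (1 + t) - 1) * fps_pderiv_t (fps_pderiv_t F)
            - 4 * t * (1 - t) * (1 - 2 * x * t) * (x * (1 + t) - 1) * fps_pderiv_t (fps_deriv F)
            + (1 - 2 * x * t)^2 * (x * (1 + t) - 1) * fps_deriv (fps_deriv F)
            + 2 * t * (1 - t)^2 * (- 2 + (3 + t) * x) * fps_pderiv_t F
            + (4 * t - x * (1 + 3 * t)^2 + 2 * x^2 * t * (3 + 2 * t + 3 * t^2)) * fps_deriv F
            + (1 - t)^2 * F =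
    (x * (1 + t) - 1) * L (L F) + (x * (1 + 3 * t^2) - 2 * t) * L F + (1 - t)^2 * F"
proof -
  define f\<^sub>t f\<^sub>x f\<^sub>t\<^sub>t f\<^sub>x\<^sub>t f\<^sub>x\<^sub>x where
    "f\<^sub>t = fps_pderiv_t F" and "f\<^sub>x = fps_deriv F" and "f\<^sub>t\<^sub>t = fps_pderiv_t f\<^sub>t"
    and "f\<^sub>x\<^sub>t = fps_deriv f\<^sub>t" and "f\<^sub>x\<^sub>x = fps_deriv f\<^sub>x"
  note d = this
  have LF: "L F = 2 * t * (1 - t) * f\<^sub>t - (1 - 2 * x * t) * f\<^sub>x"
    by (simp add: L_def eulerian_derivation_def d x_def t_def)
  have Lf: "L f\<^sub>t = 2 * t * (1 - t) * f\<^sub>t\<^sub>t - (1 - 2 * x * t) * f\<^sub>x\<^sub>t"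
    "L f\<^sub>x = 2 * t * (1 - t) * f\<^sub>x\<^sub>t - (1 - 2 * x * t) * f\<^sub>x\<^sub>x"
    by (simp_all add: L_def eulerian_derivation_def d x_def t_def fps_pderiv_t_deriv)
  have Lc: "L t = 2 * t * (1 - t)" "L x = - (1 - 2 * x * t)" "L 1 = 0" "L 2 = 0"
    unfolding L_def t_def x_def by (rule eulerian_derivation_t eulerian_derivation_X
      eulerian_derivation_1 eulerian_derivation_numeral)+
  have LLF: "L (L F) = 2 * t * (1 - t) * (2 * t * (1 - t) * f\<^sub>t\<^sub>t - (1 - 2 * x * t) * f\<^sub>x\<^sub>t)
      + 2 * (2 * t * (1 - t)) * (1 - 2 * t) * f\<^sub>t
      - (1 - 2 * x * t) * (2 * t * (1 - t) * f\<^sub>x\<^sub>t - (1 - 2 * x * t) * f\<^sub>x\<^sub>x)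
      + 2 * (x * (2 * t * (1 - t)) - (1 - 2 * x * t) * t) * f\<^sub>x"
    unfolding LF eulerian_derivation_diff[folded L_def] eulerian_derivation_mult[folded L_def] Lc Lf
    by algebra
  show ?thesis
    unfolding LLF unfolding LF fps_pderiv_t_deriv unfolding d[symmetric] by algebra
qed

text \<open>The equation holds for \<open>B\<close> and for \<open>x t C\<close> separately. For \<open>B\<close> it follows from
  \<open>L B = - (1 + t) B\<close> and \<open>L (L B) = (1 + 3 t\<^sup>2) B\<close>; for the other summand, \<open>L (x t C) = - t C\<close> and
  \<open>L (t C) = - 2 t (t C)\<close>. In each case the coefficients add up to \<open>0\<close>.\<close>

lemma operator_identity:
  fixes B C :: "real poly fps"
  defines "x \<equiv> fps_X" and "t \<equiv> fps_t" and "L \<equiv> eulerian_derivation"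
  assumes B: "L B = - (1 + t) * B" and C: "L C = - 2 * C"
  shows "(x * (1 + t) - 1) * L (L (B - x * t * C))
    + (x * (1 + 3 * t^2) - 2 * t) * L (B - x * t * C) + (1 - t)^2 * (B - x * t * C) = 0"
proof -
  have t: "L t = 2 * t * (1 - t)" and x: "L x = - (1 - 2 * x * t)"
    unfolding L_def t_def x_def by (rule eulerian_derivation_t eulerian_derivation_X)+
  have L0: "L 0 = 0" by (simp add: L_def eulerian_derivation_def)
  note mult = eulerian_derivation_mult[folded L_def]
  note add = eulerian_derivation_add[folded L_def] eulerian_derivation_diff[folded L_def]
  have LtC: "L (t * C) = - 2 * t * (t * C)"
    unfolding mult t C by algebra
  have LxtC: "L (x * t * C) = - (t * C)"
    unfolding mult[of x "t * C", folded mult.assoc] mult.assoc mult[of x] LtC x by algebra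
  have LLB: "L (L B) = (1 + 3 * t^2) * B"
  proof -
    have LB: "L B = - B - t * B" unfolding B by algebra
    have "L (- B - t * B) = L 0 - L B - L (t * B)" by (simp flip: add(2))
    also have "\<dots> = (1 + 3 * t^2) * B"
      unfolding LB mult t using L0 by algebra
    finally show ?thesis by (simp only: LB)
  qed
  have LD: "L (B - x * t * C) = - (1 + t) * B + t * C"
    unfolding add LxtC B by simp
  have "L (L (B - x * t * C)) = L (L B) + L (t * C)"
    unfolding LD unfolding B add(1) ..
  then have LLD: "L (L (B - x * t * C)) = (1 + 3 * t^2) * B - 2 * t * (t * C)"
    unfolding LLB LtC by simp
  show ?thesis unfolding LLD unfolding LD by algebra
qed

text \<open>The terms of \<open>worpitzky_recurrence\<close> without a derivative, and without the factor \<open>n\<close>, are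
  multiplications by polynomials in \<open>t\<close>, which become the factor on the right.\<close>

lemma eulerian_derivation_worpitzky_egf:
  fixes p :: "nat \<Rightarrow> real poly"
  assumes p: "\<And>n. fps_of_poly (p n) = (1 - fps_X) ^ (n + 1) * Abs_fps (\<lambda>k. (2 * of_nat k + d) ^ n)"
  shows "eulerian_derivation (Abs_fps (\<lambda>n. smult (1 / fact n) (p n))) =
    - (2 * fps_t + fps_const [:d:] * (1 - fps_t)) * Abs_fps (\<lambda>n. smult (1 / fact n) (p n))"
    (is "_ = ?c * ?W")
proof (rule fps_ext)
  fix n
  let ?t = "[:0, 1:] :: real poly"
  have rec: "p (n + 1) = 2 * ?t * (1 - ?t) * pderiv (p n)
      + (2 * of_nat (n + 1) * ?t + [:d:] * (1 - ?t)) * p n"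
    by (rule worpitzky_recurrence[OF p]) (use p[of "n + 1"] in simp)
  have c: "2 * fps_t * (1 - fps_t) = fps_const (2 * ?t * (1 - ?t))" "2 * fps_X * fps_t = fps_const (2 * ?t) * fps_X"
    "?c = fps_const (- (2 * ?t + [:d:] * (1 - ?t)))"
    by (simp_all add: fps_t_def fps_numeral_fps_const mult_ac flip: fps_const_1_eq_1)
  define u where "u = [:1 / fact n :: real:]"
  have u: "smult (1 / fact n) q = u * q" for q :: "real poly" by (simp add: u_def)
  have deriv: "fps_nth (fps_deriv ?W) n = u * p (n + 1)"
    by (simp add: u_def of_nat_poly field_simps del: of_nat_Suc)
  have X_deriv: "fps_nth (fps_X * fps_deriv ?W) n = of_nat n * (u * p n)"
    by (cases n) (simp_all add: u_def of_nat_poly)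
  have expand: "eulerian_derivation ?W = fps_const (2 * ?t * (1 - ?t)) * fps_pderiv_t ?W
      - fps_deriv ?W + fps_const (2 * ?t) * (fps_X * fps_deriv ?W)"
    unfolding eulerian_derivation_def c by algebra
  have "fps_nth (eulerian_derivation ?W) n =
      2 * ?t * (1 - ?t) * (u * pderiv (p n)) - u * p (n + 1) + 2 * ?t * (of_nat n * (u * p n))"
    unfolding expand fps_add_nth fps_sub_nth fps_mult_left_const_nth deriv X_deriv
    by (simp add: pderiv_smult flip: u)
  also have "\<dots> = - (2 * ?t + [:d:] * (1 - ?t)) * (u * p n)"
    unfolding rec of_nat_add of_nat_1 by algebra
  also have "\<dots> = fps_nth (?c * ?W) n"
    unfolding c fps_mult_left_const_nth by (simp add: u)
  finally show "fps_nth (eulerian_derivation ?W) n = fps_nth (?c * ?W) n" .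
qed

section \<open>The type D generating function\<close>

lemma worpitzky_type_B_poly:
  "fps_of_poly (type_B_poly n) = (1 - fps_X) ^ (n + 1) * Abs_fps (\<lambda>k. (2 * of_nat k + 1) ^ n)"
  unfolding type_B_poly_def by (subst worpitzky_type_B) auto

lemma worpitzky_signed_A_poly:
  "fps_of_poly (signed_A_poly n) = (1 - fps_X) ^ (n + 1) * Abs_fps (\<lambda>k. (2 * of_nat k + 2) ^ n)"
  unfolding signed_A_poly_def by (subst worpitzky_signed_type_A) auto

definition type_B_egf :: "real poly fps" where
  "type_B_egf = Abs_fps (\<lambda>n. smult (1 / fact n) (type_B_poly n))"

definition signed_A_egf :: "real poly fps" where
  "signed_A_egf = Abs_fps (\<lambda>n. smult (1 / fact n) (signed_A_poly n))"

text \<open>This is Stembridge's identity in terms of generating functions, where \<open>n / fact n\<close> becomes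
  \<open>1 / fact (n - 1)\<close>. It includes the conventional values for \<open>n = 0\<close> and \<open>n = 1\<close>.\<close>

lemma eulerian_D_egf_decomposition:
  "eulerian_D_egf = type_B_egf - fps_X * fps_t * signed_A_egf"
proof (rule fps_ext)
  fix n
  show "fps_nth eulerian_D_egf n = fps_nth (type_B_egf - fps_X * fps_t * signed_A_egf) n"
  proof (cases n)
    case 0
    then show ?thesis
      by (simp add: eulerian_D_egf_def type_B_egf_def eulerian_D_def type_B_poly_def mult.assoc monom_0 one_pCons)
  next
    case (Suc m)
    have "eulerian_D n = type_B_poly n - of_nat n * [:0, 1:] * signed_A_poly m"
      using stembridge[of n] Suc by simp
    then have "smult (1 / fact n) (eulerian_D n) = smult (1 / fact n) (type_B_poly n)
        - smult (of_nat n / fact n) ([:0, 1:] * signed_A_poly m)"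
      by (simp add: smult_diff_right of_nat_poly)
    also have "of_nat n / fact n = 1 / (fact m :: real)"
      by (simp add: Suc del: of_nat_Suc)
    finally show ?thesis
      by (simp add: eulerian_D_egf_def type_B_egf_def signed_A_egf_def fps_t_def Suc mult.assoc
        del: mult_pCons_left)
  qed
qed

lemma eulerian_derivation_type_B_egf:
  "eulerian_derivation type_B_egf = - (1 + fps_t) * type_B_egf"
proof -
  have "fps_const [:1:] = (1 :: real poly fps)" by (simp flip: one_pCons)
  then have "- (2 * fps_t + fps_const [:1:] * (1 - fps_t)) = - (1 + fps_t)"
    by algebra
  then show ?thesis
    using eulerian_derivation_worpitzky_egf[OF worpitzky_type_B_poly]
    by (simp only: type_B_egf_def)
qed

lemma eulerian_derivation_signed_A_egf:
  "eulerian_derivation signed_A_egf = - 2 * signed_A_egf"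
proof -
  have "fps_const [:2:] = (2 :: real poly fps)" by (simp add: fps_numeral_fps_const numeral_poly)
  then have "- (2 * fps_t + fps_const [:2:] * (1 - fps_t)) = - 2"
    by (simp only:) (simp add: algebra_simps)
  then show ?thesis
    using eulerian_derivation_worpitzky_egf[OF worpitzky_signed_A_poly]
    by (simp only: signed_A_egf_def)
qed

theorem proposition5p2:
  shows "let x = (fps_X :: real poly fps);
             t = (fps_const [:0, 1:] :: real poly fps);
             D = eulerian_D_egf;
             D\<^sub>x = fps_deriv D;
             D\<^sub>t = fps_pderiv_t D;
             D\<^sub>x\<^sub>x = fps_deriv D\<^sub>x;
             D\<^sub>x\<^sub>t = fps_pderiv_t D\<^sub>x;
             D\<^sub>t\<^sub>t = fps_pderiv_t D\<^sub>t
         in 4 * t^2 * (1 - t)^2 * (x * (1 + t) - 1) * D\<^sub>t\<^sub>t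
            - 4 * t * (1 - t) * (1 - 2 * x * t) * (x * (1 + t) - 1) * D\<^sub>x\<^sub>t
            + (1 - 2 * x * t)^2 * (x * (1 + t) - 1) * D\<^sub>x\<^sub>x
            + 2 * t * (1 - t)^2 * (- 2 + (3 + t) * x) * D\<^sub>t
            + (4 * t - x * (1 + 3 * t)^2 + 2 * x^2 * t * (3 + 2 * t + 3 * t^2)) * D\<^sub>x
            + (1 - t)^2 * D = 0"
  unfolding Let_def fps_t_def[symmetric] pde_as_operator eulerian_D_egf_decomposition
  by (rule operator_identity[OF eulerian_derivation_type_B_egf eulerian_derivation_signed_A_egf])

end
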